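(* Let $0<a<b<\infty$, $0<c<d<\infty$, let $f:[a,b]\times[c,d]\to\mathbb{R}$ be continuous, and let $\gamma=(\gamma_1,\gamma_2)$. (1) If $0<\gamma_1,\gamma_2<1$, then $$2\le \dim_H \mathrm{Gr}(\mathcal{I}^{\gamma}f,I\times J)\le \dim_B \mathrm{Gr}(\mathcal{I}^{\gamma}f,I\times J)\le 3-\min\{\gamma_1,\gamma_2\}.$$ (2) If $\gamma_1,\gamma_2\ge 1$, then $$\dim_H \mathrm{Gr}(\mathcal{I}^{\gamma}f,I\times J)=\dim_B \mathrm{Gr}(\mathcal{I}^{\gamma}f,I\times J)=2.$$ Here $I\times J=[a,b]\times[c,d]$.
   Context: For $\gamma=(\gamma_1,\gamma_2)$ with $\gamma_1,\gamma_2>0$, the mixed Riemann-Liouville fractional integral of $f$ on $[a,b]\times[c,d]$ is $$\mathcal{I}^{\gamma}f(x,y)=\frac{1}{\Gamma(\gamma_1)\Gamma(\gamma_2)}\int_a^x\int_c^y (x-u)^{\gamma_1-1}(y-v)^{\gamma_2-1}f(u,v)\,du\,dv .$$ $\mathrm{Gr}(g,I\times J)=\{(x,y,g(x,y)):(x,y)\in I\times J\}\subset\mathbb{R}^3$ is the graph of $g$ over $I\times J=[a,b]\times[c,d]$. $\dim_H$ is the Hausdorff dimension. For a nonempty bounded set $E\subset\mathbb{R}^n$, $N_\delta(E)$ is the smallest number of sets of diameter at most $\delta$ that cover $E$; the upper and lower box dimensions $\overline{\dim}_B(E)$, $\underline{\dim}_B(E)$ are the $\limsup$ and $\liminf$ as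 $\delta\to0$ of $\frac{\log N_\delta(E)}{-\log\delta}$. If they coincide, the common value $\lim_{\delta\to0}\frac{\log N_\delta(E)}{-\log\delta}$ is the box dimension $\dim_B(E)$.
   Formalization: In (1) the box dimension need not exist for every continuous f, so the chain is proved with lower and upper box dimensions in place of dim_B, and with dim_B itself whenever it exists; existence of dim_B is asserted only in (2). *)

theory Defs
  imports "HOL-Analysis.Analysis"
begin

definition RL_integral ::
    "real \<Rightarrow> real \<Rightarrow> real \<Rightarrow> real \<Rightarrow> (real \<times> real \<Rightarrow> real) \<Rightarrow> real \<times> real \<Rightarrow> real"
  where "RL_integral a c \<gamma>1 \<gamma>2 f = (\<lambda>(x, y).
    1 / (Gamma \<gamma>1 * Gamma \<gamma>2) *
      (LBINT u:{a..x}. (LBINT v:{c..y}.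
         (x - u) powr (\<gamma>1 - 1) * (y - v) powr (\<gamma>2 - 1) * f (u, v))))"

text \<open>Space \<open>\<real>\<^sup>3\<close> is represented as \<^typ>\<open>real \<times> real \<times> real\<close>, whose library metric is the
  Euclidean one.\<close>

definition Gr :: "(real \<times> real \<Rightarrow> real) \<Rightarrow> (real \<times> real) set \<Rightarrow> (real \<times> real \<times> real) set"
  where "Gr g S = {(x, y, g (x, y)) | x y. (x, y) \<in> S}"

text \<open>Since \<^const>\<open>diameter\<close> is only meaningful for bounded sets, boundedness is required explicitly.\<close>

definition small_set :: "real \<Rightarrow> 'a::metric_space set \<Rightarrow> bool"
  where "small_set \<delta> U \<longleftrightarrow> bounded U \<and> diameter U \<le> \<delta>"

text \<open>The \<open>s\<close>-th power of the diameter, with the usual conventions \<open>0\<^sup>0 = 1\<close> for nonempty sets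
  (so that \<open>s = 0\<close> gives counting measure; note that \<^term>\<open>0 powr 0 = (0::real)\<close>)
  and value \<open>0\<close> for the empty set.\<close>

definition diam_pow :: "real \<Rightarrow> 'a::metric_space set \<Rightarrow> ennreal"
  where "diam_pow s U =
    (if U = {} then 0 else if s = 0 then 1 else ennreal (diameter U powr s))"

text \<open>Covers are indexed by \<^typ>\<open>nat\<close>; finite covers are included by padding with empty sets.\<close>

definition hausdorff_premeasure :: "real \<Rightarrow> real \<Rightarrow> 'a::metric_space set \<Rightarrow> ennreal"
  where "hausdorff_premeasure \<delta> s E =
    (INF U \<in> {U :: nat \<Rightarrow> 'a set. (\<forall>i. small_set \<delta> (U i)) \<and> E \<subseteq> (\<Union>i. U i)}.
       \<Sum>i. diam_pow s (U i))"

definition hausdorff_measure :: "real \<Rightarrow> 'a::metric_space set \<Rightarrow> ennreal"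
  where "hausdorff_measure s E = (SUP \<delta> \<in> {0<..}. hausdorff_premeasure \<delta> s E)"

definition hausdorff_dim :: "'a::metric_space set \<Rightarrow> ereal"
  where "hausdorff_dim E = Inf {ereal s | s. 0 \<le> s \<and> hausdorff_measure s E = 0}"

text \<open>Covering numbers and box dimensions are intended for nonempty bounded sets.\<close>

definition covering_number :: "real \<Rightarrow> 'a::euclidean_space set \<Rightarrow> nat"
  where "covering_number \<delta> E =
    (LEAST n. \<exists>C. finite C \<and> card C = n \<and> (\<forall>U\<in>C. small_set \<delta> U) \<and> E \<subseteq> \<Union>C)"

definition upper_box_dim :: "'a::euclidean_space set \<Rightarrow> ereal"
  where "upper_box_dim E =
    Limsup (at_right 0) (\<lambda>\<delta>. ereal (ln (real (covering_number \<delta> E)) / (- ln \<delta>)))"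

definition lower_box_dim :: "'a::euclidean_space set \<Rightarrow> ereal"
  where "lower_box_dim E =
    Liminf (at_right 0) (\<lambda>\<delta>. ereal (ln (real (covering_number \<delta> E)) / (- ln \<delta>)))"

text \<open>The box dimension of \<open>E\<close> exists and equals \<open>D\<close>.\<close>

definition has_box_dim :: "'a::euclidean_space set \<Rightarrow> ereal \<Rightarrow> bool"
  where "has_box_dim E D \<longleftrightarrow> lower_box_dim E = D \<and> upper_box_dim E = D"

lemma has_box_dim_iff_tendsto:
  "has_box_dim E D \<longleftrightarrow>
    ((\<lambda>\<delta>. ereal (ln (real (covering_number \<delta> E)) / (- ln \<delta>))) \<longlongrightarrow> D) (at_right 0)"
  unfolding has_box_dim_def lower_box_dim_def upper_box_dim_def
  by (subst tendsto_iff_Liminf_eq_Limsup) auto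

end

theory Submission
  imports Defs
begin

text \<open>The proof compares three quantities for the graph \<open>G\<close> of the fractional integral.

  From below, \<open>2 \<le> hausdorff_dim G\<close> holds for the graph of any function over a nondegenerate
  rectangle: projecting to the plane does not increase distances, and the projection has positive
  area (\<open>hausdorff_dim_graph_ge\<close>). In the middle, Hausdorff dimension never exceeds lower box
  dimension, because a cover by sets of equal size is a special cover
  (\<open>hausdorff_dim_le_lower_box_dim\<close>).

  From above, the one-variable kernel \<open>(x - u)\<^bsup>\<gamma>-1\<^esup>\<close>, cut off to \<open>[a, x]\<close>, depends on \<open>x\<close> in a Hoelder
  continuous way in \<open>L\<^sup>1\<close>, with exponent \<open>min \<gamma> 1\<close> (\<open>RL_kernel_L1_Hoelder\<close>). Since \<open>f\<close> is bounded,
  the fractional integral inherits this exponent in each of the two variables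
  (\<open>RL_integral_bounded_and_Hoelder\<close>). Its oscillation over a square of side \<open>h \<le> 1\<close> is therefore of
  order at most \<open>h\<^sup>\<theta>\<close> with \<open>\<theta> = min 1 (min \<gamma>1 \<gamma>2)\<close>, and counting mesh cubes gives upper box dimension at
  most \<open>3 - \<theta>\<close> (\<open>upper_box_dim_graph_le\<close>). For \<open>\<gamma>1, \<gamma>2 < 1\<close> this is \<open>3 - min \<gamma>1 \<gamma>2\<close>; for
  \<open>\<gamma>1, \<gamma>2 \<ge> 1\<close> it is 2, and all the dimensions coincide.\<close>

section \<open>Hoelder continuity of the mixed fractional integral\<close>

text \<open>The cut-off at \<open>a\<close> and \<open>x\<close> is part of the kernel, so that fractional integrals with different
  upper limits are integrals over the whole line, whose difference is controlled by the \<open>L\<^sup>1\<close> distance of the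
  kernels.\<close>

definition RL_kernel :: "real \<Rightarrow> real \<Rightarrow> real \<Rightarrow> real \<Rightarrow> real"
  where "RL_kernel \<gamma> a x u = indicator {a..x} u * (x - u) powr (\<gamma> - 1)"

lemma RL_kernel_nonneg: "0 \<le> RL_kernel \<gamma> a x u"
  by (simp add: RL_kernel_def)

lemma RL_kernel_measurable [measurable]: "RL_kernel \<gamma> a x \<in> borel_measurable borel"
  unfolding RL_kernel_def by measurable

text \<open>For \<open>\<gamma> < 1\<close> the kernel is unbounded near \<open>u = x\<close>, but its antiderivative stays continuous there;
  the fundamental theorem of calculus needs differentiability only in the interior, and
  nonnegativity turns the resulting gauge integral into a Lebesgue integral.\<close>

lemma has_bochner_integral_RL_kernel:
  assumes "0 < \<gamma>" "a \<le> x"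
  shows "has_bochner_integral lborel (RL_kernel \<gamma> a x) ((x - a) powr \<gamma> / \<gamma>)"
proof -
  define F where "F u = - ((x - u) powr \<gamma> / \<gamma>)" for u
  have "((\<lambda>u. (x - u) powr (\<gamma> - 1)) has_integral (F x - F a)) {a..x}"
  proof (rule fundamental_theorem_of_calculus_interior)
    show "continuous_on {a..x} F"
      unfolding F_def using assms by (intro continuous_intros continuous_on_powr') auto
    show "(F has_vector_derivative (x - u) powr (\<gamma> - 1)) (at u)" if "u \<in> {a<..<x}" for u
      unfolding F_def has_real_derivative_iff_has_vector_derivative[symmetric]
      using that assms by (auto intro!: derivative_eq_intros simp: powr_diff)
  qed (use assms in simp)
  then have "integral\<^sup>N lborel (\<lambda>u. indicator {a..x} u * (x - u) powr (\<gamma> - 1)) = F x - F a"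
    by (intro nn_integral_has_integral_lebesgue) auto
  then show ?thesis
    using assms RL_kernel_nonneg
    by (intro has_bochner_integral_nn_integral) (auto simp: RL_kernel_def F_def)
qed

lemmas integrable_RL_kernel = integrable.intros[OF has_bochner_integral_RL_kernel]
  and integral_RL_kernel = has_bochner_integral_integral_eq[OF has_bochner_integral_RL_kernel]

lemma powr_diff_le:
  fixes p q r :: real
  assumes "1 \<le> r" "0 \<le> p" "p \<le> q"
  shows "q powr r - p powr r \<le> r * q powr (r - 1) * (q - p)"
proof (cases "p = q")
  case False
  have cont: "continuous_on {p..q} (\<lambda>t. t powr r)"
    using assms by (intro continuous_on_powr' continuous_intros) auto
  have deriv: "((\<lambda>t. t powr r) has_derivative (*) (r * t powr (r - 1))) (at t)"
    if "p < t" "t < q" for t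
    using that assms has_real_derivative_powr[of t r]
    by (auto simp: has_field_derivative_def)
  have "p < q" using False assms by simp
  then obtain t where t: "p < t" "t < q" "q powr r - p powr r = r * t powr (r - 1) * (q - p)"
    using mvt[OF _ cont deriv] by blast
  then show ?thesis
    using assms by (auto intro!: mult_mono powr_mono2)
qed simp

text \<open>For an exponent \<open>\<gamma> - 1 < 0\<close> the kernel decreases on \<open>[a, x)\<close> when \<open>x\<close> moves right to \<open>x'\<close>, and new
  mass appears only on \<open>[x, x']\<close>. The mass lost is thus at most the mass gained, which is
  \<open>(x' - x)\<^sup>\<gamma> / \<gamma>\<close>.\<close>

lemma RL_kernel_L1_diff_singular:
  assumes "0 < \<gamma>" "\<gamma> < 1" "a \<le> x" "x \<le> x'"
  shows "(\<integral>u. \<bar>RL_kernel \<gamma> a x' u - RL_kernel \<gamma> a x u\<bar> \<partial>lborel) \<le> 2 / \<gamma> * (x' - x) powr \<gamma>"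
proof -
  have [simp]: "integrable lborel (RL_kernel \<gamma> a x)" "integrable lborel (RL_kernel \<gamma> a x')"
    "integrable lborel (RL_kernel \<gamma> x x')"
    using assms by (auto intro: integrable_RL_kernel)
  \<comment> \<open>On \<open>[x, x']\<close> the first two terms count the new mass negatively; adding it twice repairs the sign.\<close>
  let ?r = "\<lambda>u. RL_kernel \<gamma> a x u - RL_kernel \<gamma> a x' u + 2 * RL_kernel \<gamma> x x' u"
  have "\<bar>RL_kernel \<gamma> a x' u - RL_kernel \<gamma> a x u\<bar> \<le> ?r u" for u
  proof (cases "a \<le> u \<and> u < x")
    case True
    then have "(x' - u) powr (\<gamma> - 1) \<le> (x - u) powr (\<gamma> - 1)"
      using assms by (intro powr_mono2') auto
    then show ?thesis using True assms by (auto simp: RL_kernel_def)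
  next
    case False
    then show ?thesis using assms by (auto simp: RL_kernel_def indicator_def)
  qed
  then have "(\<integral>u. \<bar>RL_kernel \<gamma> a x' u - RL_kernel \<gamma> a x u\<bar> \<partial>lborel) \<le> (\<integral>u. ?r u \<partial>lborel)"
    by (intro integral_mono) auto
  also have "\<dots> = (x - a) powr \<gamma> / \<gamma> - (x' - a) powr \<gamma> / \<gamma> + 2 * ((x' - x) powr \<gamma> / \<gamma>)"
    using assms by (simp add: integral_RL_kernel)
  also have "\<dots> \<le> 2 * ((x' - x) powr \<gamma> / \<gamma>)"
    using assms by (auto intro!: divide_right_mono powr_mono2)
  finally show ?thesis by simp
qed

text \<open>For \<open>\<gamma> \<ge> 1\<close> the kernel increases with \<open>x\<close>, so the distance is the difference of the total masses,
  and \<open>t \<mapsto> t\<^sup>\<gamma>\<close> is Lipschitz on bounded intervals.\<close>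

lemma RL_kernel_L1_diff_regular:
  assumes "1 \<le> \<gamma>" "a \<le> x" "x \<le> x'" "x' \<le> b"
  shows "(\<integral>u. \<bar>RL_kernel \<gamma> a x' u - RL_kernel \<gamma> a x u\<bar> \<partial>lborel)
           \<le> (b - a) powr (\<gamma> - 1) * (x' - x)"
proof -
  have "RL_kernel \<gamma> a x u \<le> RL_kernel \<gamma> a x' u" for u
    using assms by (auto simp: RL_kernel_def indicator_def intro!: powr_mono2)
  then have "(\<integral>u. \<bar>RL_kernel \<gamma> a x' u - RL_kernel \<gamma> a x u\<bar> \<partial>lborel)
      = (\<integral>u. RL_kernel \<gamma> a x' u - RL_kernel \<gamma> a x u \<partial>lborel)"
    by simp
  also have "\<dots> = ((x' - a) powr \<gamma> - (x - a) powr \<gamma>) / \<gamma>"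
    using assms by (simp add: integrable_RL_kernel integral_RL_kernel diff_divide_distrib)
  also have "\<dots> \<le> (\<gamma> * (x' - a) powr (\<gamma> - 1) * (x' - x)) / \<gamma>"
    using powr_diff_le[of \<gamma> "x - a" "x' - a"] assms by (intro divide_right_mono) auto
  also have "\<dots> = (x' - a) powr (\<gamma> - 1) * (x' - x)"
    using assms by simp
  also have "\<dots> \<le> (b - a) powr (\<gamma> - 1) * (x' - x)"
    using assms by (intro mult_right_mono powr_mono2) auto
  finally show ?thesis .
qed

lemma RL_kernel_L1_Hoelder:
  assumes "0 < \<gamma>"
  obtains C where "0 \<le> C" and
    "\<And>x x'. x \<in> {a..b} \<Longrightarrow> x' \<in> {a..b} \<Longrightarrow>
       (\<integral>u. \<bar>RL_kernel \<gamma> a x' u - RL_kernel \<gamma> a x u\<bar> \<partial>lborel) \<le> C * \<bar>x' - x\<bar> powr (min \<gamma> 1)"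
proof -
  define C where "C = (if \<gamma> < 1 then 2 / \<gamma> else (b - a) powr (\<gamma> - 1))"
  have le: "(\<integral>u. \<bar>RL_kernel \<gamma> a x' u - RL_kernel \<gamma> a x u\<bar> \<partial>lborel) \<le> C * \<bar>x' - x\<bar> powr (min \<gamma> 1)"
    if "a \<le> x" "x \<le> x'" "x' \<le> b" for x x'
    using RL_kernel_L1_diff_singular[of \<gamma> a x x'] RL_kernel_L1_diff_regular[of \<gamma> a x x' b] that assms
    by (auto simp: C_def)
  show ?thesis
  proof (rule that[of C])
    fix x x' assume "x \<in> {a..b}" "x' \<in> {a..b}"
    then show "(\<integral>u. \<bar>RL_kernel \<gamma> a x' u - RL_kernel \<gamma> a x u\<bar> \<partial>lborel)
        \<le> C * \<bar>x' - x\<bar> powr (min \<gamma> 1)"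
      using le[of x x'] le[of x' x] by (cases "x \<le> x'") (auto simp: abs_minus_commute)
  qed (use assms in \<open>simp add: C_def\<close>)
qed

lemma integrable_mult_bounded:
  fixes k g :: "real \<Rightarrow> real"
  assumes "integrable lborel k" "g \<in> borel_measurable borel" "\<And>u. \<bar>g u\<bar> \<le> M"
  shows "integrable lborel (\<lambda>u. k u * g u)"
proof -
  have "\<bar>g u\<bar> \<le> \<bar>M\<bar>" for u using assms(3)[of u] by linarith
  then show ?thesis
    using assms(1,2)
    by (intro Bochner_Integration.integrable_bound[where f = "\<lambda>u. k u * M" and g = "\<lambda>u. k u * g u"])
      (auto simp: abs_mult intro!: AE_I2 mult_left_mono)
qed

lemma integral_mult_bounded_le:
  fixes k g :: "real \<Rightarrow> real"
  assumes "integrable lborel k" "g \<in> borel_measurable borel" "\<And>u. \<bar>g u\<bar> \<le> M"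
  shows "\<bar>\<integral>u. k u * g u \<partial>lborel\<bar> \<le> (\<integral>u. \<bar>k u\<bar> \<partial>lborel) * M"
proof -
  have "\<bar>\<integral>u. k u * g u \<partial>lborel\<bar> \<le> (\<integral>u. \<bar>k u\<bar> * M \<partial>lborel)"
    using assms by (intro integral_abs_bound_integral integrable_mult_bounded)
      (auto simp: abs_mult intro!: mult_left_mono)
  also have "\<dots> = (\<integral>u. \<bar>k u\<bar> \<partial>lborel) * M"
    using assms by simp
  finally show ?thesis .
qed

lemma RL_transform_bound:
  assumes "0 < \<gamma>" "x \<in> {a..b}" "g \<in> borel_measurable borel" "\<And>u. \<bar>g u\<bar> \<le> M"
  shows "\<bar>\<integral>u. RL_kernel \<gamma> a x u * g u \<partial>lborel\<bar> \<le> (b - a) powr \<gamma> / \<gamma> * M"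
proof -
  have "0 \<le> M" using assms(4)[of 0] by linarith
  have "\<bar>\<integral>u. RL_kernel \<gamma> a x u * g u \<partial>lborel\<bar> \<le> (x - a) powr \<gamma> / \<gamma> * M"
    using integral_mult_bounded_le[of "RL_kernel \<gamma> a x" g M] assms
    by (simp add: integrable_RL_kernel integral_RL_kernel RL_kernel_nonneg)
  also have "\<dots> \<le> (b - a) powr \<gamma> / \<gamma> * M"
    using assms \<open>0 \<le> M\<close> by (intro mult_right_mono divide_right_mono powr_mono2) auto
  finally show ?thesis .
qed

lemma RL_transform_diff_bound:
  assumes "0 < \<gamma>" "x \<in> {a..b}" "x' \<in> {a..b}"
    and "g \<in> borel_measurable borel" "\<And>u. \<bar>g u\<bar> \<le> M"
  shows "\<bar>(\<integral>u. RL_kernel \<gamma> a x' u * g u \<partial>lborel) - (\<integral>u. RL_kernel \<gamma> a x u * g u \<partial>lborel)\<bar>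
           \<le> (\<integral>u. \<bar>RL_kernel \<gamma> a x' u - RL_kernel \<gamma> a x u\<bar> \<partial>lborel) * M"
proof -
  have "(\<integral>u. RL_kernel \<gamma> a x' u * g u \<partial>lborel) - (\<integral>u. RL_kernel \<gamma> a x u * g u \<partial>lborel)
      = (\<integral>u. (RL_kernel \<gamma> a x' u - RL_kernel \<gamma> a x u) * g u \<partial>lborel)"
    using assms integrable_mult_bounded[OF _ assms(4,5)]
    by (subst Bochner_Integration.integral_diff[symmetric])
      (auto simp: integrable_RL_kernel left_diff_distrib)
  then show ?thesis
    using integral_mult_bounded_le[of "\<lambda>u. RL_kernel \<gamma> a x' u - RL_kernel \<gamma> a x u" g M] assms
    by (simp add: integrable_RL_kernel)
qed

text \<open>Extending by zero outside the rectangle makes every section of \<open>f\<close> a bounded Borel function on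
  the whole line, the form in which the one-variable estimates apply.\<close>

lemma zero_extension_measurable_bounded:
  fixes f :: "real \<times> real \<Rightarrow> real"
  assumes "continuous_on ({a..b} \<times> {c..d}) f"
  defines "f0 \<equiv> \<lambda>p::real \<times> real. indicator ({a..b} \<times> {c..d}) p * f p"
  obtains M :: real where "f0 \<in> borel_measurable borel" "\<And>p. \<bar>f0 p\<bar> \<le> M" "0 \<le> M"
proof -
  have "bounded (f ` ({a..b} \<times> {c..d}))"
    by (intro compact_imp_bounded compact_continuous_image assms compact_Times) auto
  then obtain M where M: "0 < M" "\<And>p. p \<in> {a..b} \<times> {c..d} \<Longrightarrow> \<bar>f p\<bar> \<le> M"
    unfolding bounded_pos by fastforce
  then have "\<bar>f0 p\<bar> \<le> M" for p
    unfolding f0_def by (cases "p \<in> {a..b} \<times> {c..d}") auto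
  moreover have "f0 \<in> borel_measurable borel"
    using borel_measurable_continuous_on_indicator[OF _ assms(1)]
    unfolding f0_def by (auto simp: closed_Times)
  ultimately show ?thesis using M(1) by (intro that[of M]) auto
qed

lemma RL_integral_eq_iterated:
  fixes f :: "real \<times> real \<Rightarrow> real"
  assumes "x \<in> {a..b}" "y \<in> {c..d}"
  defines "f0 \<equiv> \<lambda>p. indicator ({a..b} \<times> {c..d}) p * f p"
  shows "RL_integral a c \<gamma>1 \<gamma>2 f (x, y) =
    1 / (Gamma \<gamma>1 * Gamma \<gamma>2) *
      (\<integral>u. RL_kernel \<gamma>1 a x u * (\<integral>v. RL_kernel \<gamma>2 c y v * f0 (u, v) \<partial>lborel) \<partial>lborel)"
proof -
  have "indicator {a..x} u *
        (LBINT v:{c..y}. (x - u) powr (\<gamma>1 - 1) * (y - v) powr (\<gamma>2 - 1) * f (u, v))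
      = RL_kernel \<gamma>1 a x u * (\<integral>v. RL_kernel \<gamma>2 c y v * f0 (u, v) \<partial>lborel)" for u
  proof (cases "u \<in> {a..x}")
    case True
    then have "(\<lambda>v. indicator {c..y} v *\<^sub>R
          ((x - u) powr (\<gamma>1 - 1) * (y - v) powr (\<gamma>2 - 1) * f (u, v)))
        = (\<lambda>v. (x - u) powr (\<gamma>1 - 1) * (RL_kernel \<gamma>2 c y v * f0 (u, v)))"
      using assms(1,2) by (auto simp: RL_kernel_def f0_def indicator_def)
    then show ?thesis
      using True by (simp add: RL_kernel_def set_lebesgue_integral_def)
  qed (simp add: RL_kernel_def)
  then show ?thesis
    by (simp add: RL_integral_def set_lebesgue_integral_def)
qed

text \<open>The mixed integral is a one-variable fractional integral in \<open>x\<close> of the functions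
  \<open>H y\<close>, which are fractional integrals of the sections of \<open>f\<close>. Moving \<open>x\<close> changes only the outer
  kernel; moving \<open>y\<close> changes \<open>H y\<close> uniformly by the inner kernel estimate, and the outer integral
  preserves this bound up to its total mass.\<close>

proposition RL_integral_bounded_and_Hoelder:
  fixes f :: "real \<times> real \<Rightarrow> real"
  assumes "0 < \<gamma>1" "0 < \<gamma>2" and cont: "continuous_on ({a..b} \<times> {c..d}) f"
  obtains B K where "0 \<le> K"
    and "\<And>x y. x \<in> {a..b} \<Longrightarrow> y \<in> {c..d} \<Longrightarrow> \<bar>RL_integral a c \<gamma>1 \<gamma>2 f (x, y)\<bar> \<le> B"
    and "\<And>x x' y y'. x \<in> {a..b} \<Longrightarrow> x' \<in> {a..b} \<Longrightarrow> y \<in> {c..d} \<Longrightarrow> y' \<in> {c..d} \<Longrightarrow>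
      \<bar>RL_integral a c \<gamma>1 \<gamma>2 f (x', y') - RL_integral a c \<gamma>1 \<gamma>2 f (x, y)\<bar>
        \<le> K * (\<bar>x' - x\<bar> powr min \<gamma>1 1 + \<bar>y' - y\<bar> powr min \<gamma>2 1)"
proof -
  define f0 where "f0 = (\<lambda>p. indicator ({a..b} \<times> {c..d}) p * f p)"
  obtain M where f0_meas: "f0 \<in> borel_measurable borel" and M: "\<And>p. \<bar>f0 p\<bar> \<le> M" "0 \<le> M"
    using zero_extension_measurable_bounded[OF cont] unfolding f0_def by blast
  obtain C1 where C1: "0 \<le> C1"
    "\<And>x x'. x \<in> {a..b} \<Longrightarrow> x' \<in> {a..b} \<Longrightarrow>
      (\<integral>u. \<bar>RL_kernel \<gamma>1 a x' u - RL_kernel \<gamma>1 a x u\<bar> \<partial>lborel) \<le> C1 * \<bar>x' - x\<bar> powr min \<gamma>1 1"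
    using RL_kernel_L1_Hoelder[OF assms(1), of a b] by blast
  obtain C2 where C2: "0 \<le> C2"
    "\<And>y y'. y \<in> {c..d} \<Longrightarrow> y' \<in> {c..d} \<Longrightarrow>
      (\<integral>v. \<bar>RL_kernel \<gamma>2 c y' v - RL_kernel \<gamma>2 c y v\<bar> \<partial>lborel) \<le> C2 * \<bar>y' - y\<bar> powr min \<gamma>2 1"
    using RL_kernel_L1_Hoelder[OF assms(2), of c d] by blast
  define A1 where "A1 = (b - a) powr \<gamma>1 / \<gamma>1"
  define A2 where "A2 = (d - c) powr \<gamma>2 / \<gamma>2"
  define H where "H y u = (\<integral>v. RL_kernel \<gamma>2 c y v * f0 (u, v) \<partial>lborel)" for y u
  define T where "T x g = (\<integral>u. RL_kernel \<gamma>1 a x u * g u \<partial>lborel)" for x g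
  define G where "G = 1 / (Gamma \<gamma>1 * Gamma \<gamma>2)"
  have A: "0 \<le> A1" "0 \<le> A2" "0 \<le> G"
    using assms by (auto simp: A1_def A2_def G_def Gamma_real_pos less_imp_le)
  have f0_meas2: "f0 \<in> borel_measurable (borel \<Otimes>\<^sub>M borel)"
    using f0_meas by (simp add: borel_prod)
  have f0_section: "(\<lambda>v. f0 (u, v)) \<in> borel_measurable borel" for u
    using f0_meas2 by measurable
  have H_meas: "H y \<in> borel_measurable borel" for y
  proof -
    have "(\<lambda>p. RL_kernel \<gamma>2 c y (snd p) * f0 p) \<in> borel_measurable (lborel \<Otimes>\<^sub>M lborel)"
      using f0_meas2 by measurable
    then have "(\<lambda>(u, v). RL_kernel \<gamma>2 c y v * f0 (u, v)) \<in> borel_measurable (borel \<Otimes>\<^sub>M lborel)"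
      by (simp add: case_prod_unfold cong: measurable_cong_sets)
    then show ?thesis
      unfolding H_def by (rule lborel.borel_measurable_lebesgue_integral)
  qed
  have H_bound: "\<bar>H y u\<bar> \<le> A2 * M" if "y \<in> {c..d}" for y u
    unfolding H_def A2_def
    by (rule RL_transform_bound[OF assms(2) that f0_section]) (rule M)
  have H_diff: "\<bar>H y' u - H y u\<bar> \<le> C2 * \<bar>y' - y\<bar> powr min \<gamma>2 1 * M"
    if "y \<in> {c..d}" "y' \<in> {c..d}" for y y' u
    unfolding H_def
    by (rule order_trans[OF RL_transform_diff_bound[OF assms(2) that f0_section] mult_right_mono])
      (use M C2 that in auto)
  have T_int: "integrable lborel (\<lambda>u. RL_kernel \<gamma>1 a x u * H y u)"
    if "x \<in> {a..b}" "y \<in> {c..d}" for x y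
    using that assms H_bound
    by (intro integrable_mult_bounded H_meas integrable_RL_kernel) auto
  have T_diff: "\<bar>T x' (H y') - T x (H y)\<bar>
      \<le> C1 * \<bar>x' - x\<bar> powr min \<gamma>1 1 * (A2 * M) + A1 * (C2 * \<bar>y' - y\<bar> powr min \<gamma>2 1 * M)"
    if xy: "x \<in> {a..b}" "x' \<in> {a..b}" "y \<in> {c..d}" "y' \<in> {c..d}" for x x' y y'
  proof -
    have "\<bar>T x' (H y') - T x (H y')\<bar> \<le> C1 * \<bar>x' - x\<bar> powr min \<gamma>1 1 * (A2 * M)"
      unfolding T_def
      by (rule order_trans[OF RL_transform_diff_bound[OF assms(1) xy(1,2) H_meas H_bound]
            mult_right_mono])
        (use M C1 A xy in auto)
    moreover have "T x (H y') - T x (H y) = T x (\<lambda>u. H y' u - H y u)"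
      unfolding T_def right_diff_distrib using T_int xy by simp
    moreover have "\<bar>T x (\<lambda>u. H y' u - H y u)\<bar> \<le> A1 * (C2 * \<bar>y' - y\<bar> powr min \<gamma>2 1 * M)"
      unfolding T_def A1_def
      using H_diff xy by (intro RL_transform_bound assms borel_measurable_diff H_meas) auto
    ultimately show ?thesis by linarith
  qed
  define K where "K = G * (C1 * (A2 * M) + A1 * (C2 * M))"
  have RL: "RL_integral a c \<gamma>1 \<gamma>2 f (x, y) = G * T x (H y)"
    if "x \<in> {a..b}" "y \<in> {c..d}" for x y
    using RL_integral_eq_iterated[OF that] by (simp add: G_def T_def H_def f0_def)
  show ?thesis
  proof (rule that[of K "G * (A1 * (A2 * M))"])
    show "0 \<le> K" using A M C1 C2 by (simp add: K_def)
  next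
    fix x y assume xy: "x \<in> {a..b}" "y \<in> {c..d}"
    have "\<bar>T x (H y)\<bar> \<le> A1 * (A2 * M)"
      unfolding T_def A1_def by (rule RL_transform_bound[OF assms(1) xy(1) H_meas H_bound[OF xy(2)]])
    then show "\<bar>RL_integral a c \<gamma>1 \<gamma>2 f (x, y)\<bar> \<le> G * (A1 * (A2 * M))"
      using A by (simp add: RL[OF xy] abs_mult mult_left_mono)
  next
    fix x x' y y' assume xy: "x \<in> {a..b}" "x' \<in> {a..b}" "y \<in> {c..d}" "y' \<in> {c..d}"
    let ?p = "\<bar>x' - x\<bar> powr min \<gamma>1 1" and ?q = "\<bar>y' - y\<bar> powr min \<gamma>2 1"
    have "\<bar>RL_integral a c \<gamma>1 \<gamma>2 f (x', y') - RL_integral a c \<gamma>1 \<gamma>2 f (x, y)\<bar>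
        = G * \<bar>T x' (H y') - T x (H y)\<bar>"
      using A xy by (simp add: RL abs_mult flip: right_diff_distrib)
    also have "\<dots> \<le> G * (C1 * ?p * (A2 * M) + A1 * (C2 * ?q * M))"
      using A xy by (intro mult_left_mono T_diff) auto
    also have "\<dots> \<le> G * ((C1 * (A2 * M) + A1 * (C2 * M)) * (?p + ?q))"
      using A M C1 C2 by (intro mult_left_mono) (auto simp: algebra_simps)
    finally show "\<bar>RL_integral a c \<gamma>1 \<gamma>2 f (x', y') - RL_integral a c \<gamma>1 \<gamma>2 f (x, y)\<bar>
        \<le> K * (?p + ?q)"
      by (simp add: K_def mult.assoc)
  qed
qed

section \<open>Hausdorff dimension and covering numbers\<close>

lemma covering_number_le:
  assumes "finite C" "\<And>U. U \<in> C \<Longrightarrow> small_set \<delta> U" "E \<subseteq> \<Union>C"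
  shows "covering_number \<delta> E \<le> card C"
  unfolding covering_number_def using assms by (intro Least_le) auto

lemma covering_number_attained:
  fixes E :: "'a::euclidean_space set"
  assumes "bounded E" "0 < \<delta>"
  obtains C where "finite C" "card C = covering_number \<delta> E"
    "\<And>U. U \<in> C \<Longrightarrow> small_set \<delta> U" "E \<subseteq> \<Union>C"
proof -
  have "compact (closure E)"
    using assms by (simp add: compact_closure)
  then obtain k where k: "finite k" "closure E \<subseteq> (\<Union>x\<in>k. ball x (\<delta>/2))"
    using assms unfolding compact_eq_totally_bounded by (meson half_gt_zero)
  have "small_set \<delta> (ball x (\<delta>/2))" for x :: 'a
    using assms by (simp add: small_set_def)
  then have "\<exists>n C. finite C \<and> card C = n \<and> (\<forall>U\<in>C. small_set \<delta> U) \<and> E \<subseteq> \<Union>C"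
    using k closure_subset[of E] by (intro exI[of _ "(\<lambda>x. ball x (\<delta>/2)) ` k"] exI) auto
  then have "\<exists>C. finite C \<and> card C = covering_number \<delta> E \<and> (\<forall>U\<in>C. small_set \<delta> U) \<and> E \<subseteq> \<Union>C"
    unfolding covering_number_def by (rule LeastI_ex)
  then show ?thesis using that by blast
qed

lemma hausdorff_premeasure_antimono:
  assumes "\<delta> \<le> \<delta>'"
  shows "hausdorff_premeasure \<delta>' s E \<le> hausdorff_premeasure \<delta> s E"
  unfolding hausdorff_premeasure_def
  using assms by (intro INF_superset_mono) (fastforce simp: small_set_def)+

text \<open>A finite optimal cover, padded with empty sets, is admissible for the premeasure; empty sets
  contribute nothing.\<close>

lemma hausdorff_premeasure_le_covering_number:
  fixes E :: "'a::euclidean_space set"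
  assumes "bounded E" "0 < \<delta>" "0 < s"
  shows "hausdorff_premeasure \<delta> s E \<le> ennreal (covering_number \<delta> E * \<delta> powr s)"
proof -
  obtain C where C: "finite C" "card C = covering_number \<delta> E"
    "\<And>U. U \<in> C \<Longrightarrow> small_set \<delta> U" "E \<subseteq> \<Union>C"
    using covering_number_attained[OF assms(1,2)] by blast
  define n where "n = covering_number \<delta> E"
  obtain e where e: "bij_betw e {0..<n} C"
    using ex_bij_betw_nat_finite[OF C(1)] C(2) by (auto simp: n_def)
  define U where "U i = (if i < n then e i else {})" for i
  have small: "small_set \<delta> (U i)" for i
    using C(3) e assms by (auto simp: U_def bij_betw_def small_set_def)
  have "(\<Union>i. U i) = \<Union>C"
    using e by (auto simp: U_def bij_betw_def split: if_splits; fastforce)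
  then have "hausdorff_premeasure \<delta> s E \<le> (\<Sum>i. diam_pow s (U i))"
    unfolding hausdorff_premeasure_def using small C(4) by (intro INF_lower) auto
  also have "\<dots> = (\<Sum>i<n. diam_pow s (U i))"
    by (intro suminf_finite) (auto simp: U_def diam_pow_def)
  also have "\<dots> \<le> (\<Sum>i<n. ennreal (\<delta> powr s))"
    using small assms
    by (intro sum_mono) (auto simp: diam_pow_def small_set_def diameter_ge_0 intro!: ennreal_leI powr_mono2)
  also have "\<dots> = ennreal (covering_number \<delta> E * \<delta> powr s)"
    by (simp add: n_def ennreal_mult' ennreal_of_nat_eq_real_of_nat)
  finally show ?thesis .
qed

text \<open>If \<open>lower_box_dim E < t' < t\<close>, then at arbitrarily small scales \<open>\<delta>\<close> fewer than \<open>\<delta>\<^bsup>-t'\<^esup>\<close> sets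
  suffice, and their \<open>t\<close>-cost is at most \<open>\<delta>\<^bsup>t-t'\<^esup>\<close>, which tends to zero. Hence the
  \<open>t\<close>-dimensional measure vanishes.\<close>

proposition hausdorff_dim_le_lower_box_dim:
  fixes E :: "'a::euclidean_space set"
  assumes "bounded E"
  shows "hausdorff_dim E \<le> lower_box_dim E"
proof (rule ccontr)
  define r where "r \<delta> = ln (real (covering_number \<delta> E)) / (- ln \<delta>)" for \<delta>
  assume "\<not> hausdorff_dim E \<le> lower_box_dim E"
  then have "lower_box_dim E < hausdorff_dim E" by simp
  then obtain t where t: "lower_box_dim E < ereal t" "ereal t < hausdorff_dim E"
    using ereal_dense2 by blast
  obtain t' where t': "lower_box_dim E < ereal t'" "t' < t"
    using ereal_dense2[OF t(1)] by auto
  have "\<not> ereal t' \<le> lower_box_dim E" using t'(1) by simp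
  then obtain q where q: "q < ereal t'" "\<not> eventually (\<lambda>\<delta>. q < ereal (r \<delta>)) (at_right 0)"
    unfolding lower_box_dim_def le_Liminf_iff r_def by blast
  have small_scale: "\<exists>\<delta>. 0 < \<delta> \<and> \<delta> < \<epsilon> \<and> r \<delta> < t'" if "0 < \<epsilon>" for \<epsilon>
  proof (rule ccontr)
    assume neg: "\<nexists>\<delta>. 0 < \<delta> \<and> \<delta> < \<epsilon> \<and> r \<delta> < t'"
    have "eventually (\<lambda>\<delta>. q < ereal (r \<delta>)) (at_right 0)"
      using eventually_at_right_less[of "0::real"] eventually_at_right_real[OF that]
    proof eventually_elim
      case (elim \<delta>)
      then have "\<not> r \<delta> < t'" using neg by auto
      then have "ereal t' \<le> ereal (r \<delta>)" by simp
      with q(1) show ?case by (rule less_le_trans)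
    qed
    with q(2) show False by simp
  qed
  have r_nonneg: "0 \<le> r \<delta>" if "0 < \<delta>" "\<delta> < 1" for \<delta>
  proof -
    have "0 \<le> ln (real (covering_number \<delta> E))"
      by (cases "covering_number \<delta> E = 0") auto
    then show ?thesis unfolding r_def using that by (intro divide_nonneg_nonneg) auto
  qed
  have "0 < t'" using small_scale[of 1] r_nonneg by fastforce
  with t' have "0 < t" by simp
  have "hausdorff_premeasure \<epsilon> t E = 0" if "0 < \<epsilon>" for \<epsilon>
  proof -
    have arbitrarily_small: "hausdorff_premeasure \<epsilon> t E \<le> 0 + ennreal e" if "0 < e" for e
    proof -
      \<comment> \<open>Below the last threshold, \<open>\<delta>\<^bsup>t-t'\<^esup> \<le> e\<close>.\<close>
      define \<eta> where "\<eta> = min \<epsilon> (min 1 (e powr (1 / (t - t'))))"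
      have "0 < \<eta>" using \<open>0 < \<epsilon>\<close> \<open>0 < e\<close> by (simp add: \<eta>_def)
      then obtain \<delta> where \<delta>: "0 < \<delta>" "\<delta> < \<eta>" "r \<delta> < t'"
        using small_scale by blast
      then have \<delta>': "\<delta> < \<epsilon>" "\<delta> < 1" "\<delta> < e powr (1 / (t - t'))" by (auto simp: \<eta>_def)
      have N: "real (covering_number \<delta> E) \<le> \<delta> powr (- t')"
      proof (cases "covering_number \<delta> E = 0")
        case False
        have "ln (real (covering_number \<delta> E)) \<le> t' * (- ln \<delta>)"
          using \<delta>(1,3) \<delta>'(2) unfolding r_def by (simp add: field_simps)
        then have "exp (ln (real (covering_number \<delta> E))) \<le> exp (t' * (- ln \<delta>))"
          by (simp only: exp_le_cancel_iff)
        then show ?thesis using False \<delta>(1) by (simp add: powr_def)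
      qed simp
      have "covering_number \<delta> E * \<delta> powr t \<le> \<delta> powr (- t') * \<delta> powr t"
        using N by (intro mult_right_mono) auto
      also have "\<dots> = \<delta> powr (t - t')"
        by (simp add: powr_add[symmetric])
      also have "\<dots> \<le> (e powr (1 / (t - t'))) powr (t - t')"
        using \<delta> \<delta>' t' by (intro powr_mono2) auto
      also have "\<dots> = e"
        using t' \<open>0 < e\<close> by (simp add: powr_powr)
      finally have "ennreal (covering_number \<delta> E * \<delta> powr t) \<le> ennreal e"
        by (rule ennreal_leI)
      moreover have "hausdorff_premeasure \<epsilon> t E \<le> hausdorff_premeasure \<delta> t E"
        using \<delta>' by (intro hausdorff_premeasure_antimono) simp
      moreover note hausdorff_premeasure_le_covering_number[OF assms \<delta>(1) \<open>0 < t\<close>]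
      ultimately have "hausdorff_premeasure \<epsilon> t E \<le> ennreal e"
        by (blast intro: order_trans)
      then show ?thesis by simp
    qed
    have "hausdorff_premeasure \<epsilon> t E \<le> 0"
      by (rule ennreal_le_epsilon) (rule arbitrarily_small)
    then show ?thesis by simp
  qed
  then have "hausdorff_measure t E = 0"
    by (auto simp: hausdorff_measure_def intro!: SUP_eq_const)
  then have "hausdorff_dim E \<le> ereal t"
    unfolding hausdorff_dim_def using \<open>0 < t\<close> by (intro Inf_lower) auto
  with t(2) show False by simp
qed

section \<open>Upper box dimension of graphs\<close>

lemma upper_box_dim_le:
  fixes E :: "'a::euclidean_space set"
  assumes "0 \<le> s"
    and bound: "\<And>\<delta>. 0 < \<delta> \<Longrightarrow> \<delta> < 1 \<Longrightarrow> real (covering_number \<delta> E) \<le> C * \<delta> powr (- s)"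
  shows "upper_box_dim E \<le> ereal s"
proof -
  \<comment> \<open>A constant at least 1 keeps \<open>ln D\<close> nonnegative, which covers the value \<open>ln 0 = 0\<close> of an empty cover.\<close>
  define D where "D = max C 1"
  have "ln (real (covering_number \<delta> E)) / (- ln \<delta>) \<le> ln D / (- ln \<delta>) + s"
    if "0 < \<delta>" "\<delta> < 1" for \<delta>
  proof -
    have ln_neg: "ln \<delta> < 0" using that by simp
    have "ln (real (covering_number \<delta> E)) \<le> ln D + s * (- ln \<delta>)"
    proof (cases "covering_number \<delta> E = 0")
      case True
      moreover have "0 \<le> ln D" by (simp add: D_def)
      moreover have "0 \<le> s * (- ln \<delta>)" using assms(1) ln_neg by (intro mult_nonneg_nonneg) auto
      ultimately show ?thesis by simp
    next
      case False
      have "real (covering_number \<delta> E) \<le> D * \<delta> powr (- s)"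
        by (rule order_trans[OF bound[OF that]]) (simp add: D_def mult_right_mono)
      then have "ln (real (covering_number \<delta> E)) \<le> ln (D * \<delta> powr (- s))"
        using False by (intro ln_mono) auto
      also have "\<dots> = ln D + s * (- ln \<delta>)"
        using that by (subst ln_mult) (auto simp: D_def ln_powr)
      finally show ?thesis .
    qed
    then show ?thesis using ln_neg by (simp add: field_simps)
  qed
  then have "eventually (\<lambda>\<delta>. ereal (ln (real (covering_number \<delta> E)) / (- ln \<delta>))
      \<le> ereal (ln D / (- ln \<delta>) + s)) (at_right 0)"
    using eventually_at_right_real[of 0 1] by (auto elim: eventually_mono)
  then have "upper_box_dim E \<le> Limsup (at_right 0) (\<lambda>\<delta>. ereal (ln D / (- ln \<delta>) + s))"
    unfolding upper_box_dim_def by (rule Limsup_mono)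
  also have "\<dots> = ereal s"
  proof (rule lim_imp_Limsup)
    have "filterlim (\<lambda>\<delta>::real. - ln \<delta>) at_top (at_right 0)"
      using ln_at_0 by (simp add: filterlim_uminus_at_top)
    then have "((\<lambda>\<delta>::real. ln D / (- ln \<delta>)) \<longlongrightarrow> 0) (at_right 0)"
      by (rule real_tendsto_divide_at_top[OF tendsto_const])
    then have "((\<lambda>\<delta>::real. ln D / (- ln \<delta>) + s) \<longlongrightarrow> 0 + s) (at_right 0)"
      by (intro tendsto_intros)
    then show "((\<lambda>\<delta>::real. ereal (ln D / (- ln \<delta>) + s)) \<longlongrightarrow> ereal s) (at_right 0)"
      by simp
  qed simp
  finally show ?thesis .
qed

text \<open>Partition of \<open>[l, r]\<close> into cells of length \<open>h\<close>, every left end point of which lies in \<open>[l, r]\<close>;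
  the last cell may stick out on the right.\<close>

lemma mesh_index:
  fixes x l h :: real
  assumes "0 < h" "l \<le> x" "x \<le> r"
  obtains i where "i \<le> nat \<lfloor>(r - l) / h\<rfloor>" "l + real i * h \<le> x" "x \<le> l + real i * h + h"
proof (rule that[of "nat \<lfloor>(x - l) / h\<rfloor>"])
  have pos: "0 \<le> (x - l) / h" using assms by simp
  show "nat \<lfloor>(x - l) / h\<rfloor> \<le> nat \<lfloor>(r - l) / h\<rfloor>"
    using assms by (intro nat_mono floor_mono divide_right_mono) auto
  have "real (nat \<lfloor>(x - l) / h\<rfloor>) \<le> (x - l) / h" "(x - l) / h \<le> real (nat \<lfloor>(x - l) / h\<rfloor>) + 1"
    using pos by linarith+
  then show "l + real (nat \<lfloor>(x - l) / h\<rfloor>) * h \<le> x" "x \<le> l + real (nat \<lfloor>(x - l) / h\<rfloor>) * h + h"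
    using assms(1) by (simp_all add: field_simps)
qed

lemma mesh_count:
  fixes L h :: real
  assumes "0 < h" "0 \<le> L"
  shows "real (Suc (nat \<lfloor>L / h\<rfloor>)) \<le> L / h + 1"
proof -
  have "0 \<le> L / h" using assms by simp
  then show ?thesis by linarith
qed

lemma small_set_cube:
  fixes x y z h :: real
  assumes "0 \<le> h"
  shows "small_set (2 * h) ({x..x+h} \<times> {y..y+h} \<times> {z..z+h})"
  unfolding small_set_def
proof
  show "bounded ({x..x+h} \<times> {y..y+h} \<times> {z..z+h})"
    by (intro bounded_Times) auto
  show "diameter ({x..x+h} \<times> {y..y+h} \<times> {z..z+h}) \<le> 2 * h"
  proof (rule diameter_le)
    fix p q assume pq: "p \<in> {x..x+h} \<times> {y..y+h} \<times> {z..z+h}" "q \<in> {x..x+h} \<times> {y..y+h} \<times> {z..z+h}"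
    have sq: "(s - t)\<^sup>2 \<le> h\<^sup>2" if "s \<in> {w..w+h}" "t \<in> {w..w+h}" for s t w
      using that by (intro abs_le_square_iff[THEN iffD1]) auto
    obtain p1 p2 p3 q1 q2 q3 where [simp]: "p = (p1, p2, p3)" "q = (q1, q2, q3)"
      by (metis prod.exhaust)
    have "(norm (p - q))\<^sup>2 = (p1 - q1)\<^sup>2 + (p2 - q2)\<^sup>2 + (p3 - q3)\<^sup>2"
      by (simp add: norm_Pair)
    also have "\<dots> \<le> h\<^sup>2 + h\<^sup>2 + h\<^sup>2"
      using pq by (intro add_mono sq) auto
    also have "\<dots> \<le> (2 * h)\<^sup>2" by (simp add: power2_eq_square)
    finally have "(norm (p - q))\<^sup>2 \<le> (2 * h)\<^sup>2" .
    then show "norm (p - q) \<le> 2 * h"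
      by (rule power2_le_imp_le) (use assms in simp)
  qed (use assms in auto)
qed

text \<open>Above each mesh square of side \<open>h\<close> the graph stays within \<open>w\<close> of its value at the lower left
  corner, so a column of height \<open>2 w\<close>, cut into cubes of side \<open>h\<close>, contains it. The cubes have
  diameter \<open>\<surd>3 h \<le> 2 h\<close>.\<close>

lemma covering_number_graph_le:
  fixes g :: "real \<times> real \<Rightarrow> real"
  assumes "a \<le> b" "c \<le> d" "0 < h" "0 \<le> w"
    and osc: "\<And>x x' y y'. x \<in> {a..b} \<Longrightarrow> x' \<in> {a..b} \<Longrightarrow> y \<in> {c..d} \<Longrightarrow> y' \<in> {c..d} \<Longrightarrow>
      \<bar>x' - x\<bar> \<le> h \<Longrightarrow> \<bar>y' - y\<bar> \<le> h \<Longrightarrow> \<bar>g (x', y') - g (x, y)\<bar> \<le> w"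
  shows "real (covering_number (2 * h) (Gr g ({a..b} \<times> {c..d})))
           \<le> ((b - a) / h + 1) * ((d - c) / h + 1) * (2 * w / h + 1)"
proof -
  define n1 where "n1 = nat \<lfloor>(b - a) / h\<rfloor>"
  define n2 where "n2 = nat \<lfloor>(d - c) / h\<rfloor>"
  define m where "m = nat \<lfloor>2 * w / h\<rfloor>"
  define X where "X i = a + real i * h" for i
  define Y where "Y j = c + real j * h" for j
  define Z where "Z i j k = g (X i, Y j) - w + real k * h" for i j k
  define Q where "Q = (\<lambda>(i, j, k). {X i..X i + h} \<times> {Y j..Y j + h} \<times> {Z i j k..Z i j k + h})"
  define I where "I = {..n1} \<times> {..n2} \<times> {..m}"
  have "Gr g ({a..b} \<times> {c..d}) \<subseteq> \<Union>(Q ` I)"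
  proof
    fix p assume "p \<in> Gr g ({a..b} \<times> {c..d})"
    then obtain x y where xy: "x \<in> {a..b}" "y \<in> {c..d}" and p: "p = (x, y, g (x, y))"
      by (auto simp: Gr_def)
    obtain i where i: "i \<le> n1" "X i \<le> x" "x \<le> X i + h"
      using mesh_index[of h a x b] xy assms unfolding n1_def X_def by auto
    obtain j where j: "j \<le> n2" "Y j \<le> y" "y \<le> Y j + h"
      using mesh_index[of h c y d] xy assms unfolding n2_def Y_def by auto
    have "a \<le> X i" "c \<le> Y j" using assms by (auto simp: X_def Y_def)
    then have "X i \<in> {a..b}" "Y j \<in> {c..d}" using i j xy by auto
    then have "\<bar>g (x, y) - g (X i, Y j)\<bar> \<le> w"
      using xy i j by (intro osc) auto
    then have "g (X i, Y j) - w \<le> g (x, y)" "g (x, y) \<le> g (X i, Y j) + w"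
      by linarith+
    then obtain k where k: "k \<le> m" "Z i j k \<le> g (x, y)" "g (x, y) \<le> Z i j k + h"
      using mesh_index[of h "g (X i, Y j) - w" "g (x, y)" "g (X i, Y j) + w"] assms
      unfolding m_def Z_def by auto
    show "p \<in> \<Union>(Q ` I)"
      using i j k by (auto simp: p Q_def I_def intro!: bexI[of _ "(i, j, k)"])
  qed
  moreover have "small_set (2 * h) U" if "U \<in> Q ` I" for U
    using that small_set_cube assms by (auto simp: Q_def)
  ultimately have "covering_number (2 * h) (Gr g ({a..b} \<times> {c..d})) \<le> card (Q ` I)"
    by (intro covering_number_le) (auto simp: I_def)
  also have "\<dots> \<le> card I"
    by (intro card_image_le) (auto simp: I_def)
  also have "card I = Suc n1 * Suc n2 * Suc m"
    by (simp add: I_def card_cartesian_product algebra_simps)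
  finally have "real (covering_number (2 * h) (Gr g ({a..b} \<times> {c..d})))
      \<le> real (Suc n1) * real (Suc n2) * real (Suc m)"
    unfolding of_nat_mult[symmetric] of_nat_le_iff .
  also have "\<dots> \<le> ((b - a) / h + 1) * ((d - c) / h + 1) * (2 * w / h + 1)"
    unfolding n1_def n2_def m_def using assms
    by (intro mult_mono mesh_count) auto
  finally show ?thesis .
qed

text \<open>There are of order \<open>h\<^bsup>-2\<^esup>\<close> mesh squares and at most of order \<open>h\<^bsup>\<theta>-1\<^esup>\<close> cubes above each of
  them; since \<open>1 \<le> h\<^bsup>\<theta>-1\<^esup>\<close> for \<open>\<theta> \<le> 1\<close>, the extra cube that rounding costs in each column
  only affects the constant.\<close>

proposition upper_box_dim_graph_le:
  fixes g :: "real \<times> real \<Rightarrow> real"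
  assumes "a \<le> b" "c \<le> d" "0 \<le> K" "\<theta> \<le> 1"
    and osc: "\<And>h x x' y y'. 0 < h \<Longrightarrow> h \<le> 1 \<Longrightarrow>
      x \<in> {a..b} \<Longrightarrow> x' \<in> {a..b} \<Longrightarrow> y \<in> {c..d} \<Longrightarrow> y' \<in> {c..d} \<Longrightarrow>
      \<bar>x' - x\<bar> \<le> h \<Longrightarrow> \<bar>y' - y\<bar> \<le> h \<Longrightarrow> \<bar>g (x', y') - g (x, y)\<bar> \<le> K * h powr \<theta>"
  shows "upper_box_dim (Gr g ({a..b} \<times> {c..d})) \<le> ereal (3 - \<theta>)"
proof (rule upper_box_dim_le)
  define A where "A = (b - a + 1) * (d - c + 1) * (2 * K + 1)"
  fix \<delta> :: real assume \<delta>: "0 < \<delta>" "\<delta> < 1"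
  define h where "h = \<delta> / 2"
  have half_powr: "(\<delta> / 2) powr (- r) = 2 powr r * \<delta> powr (- r)" for r
    using \<delta> by (simp add: powr_divide powr_minus field_simps)
  have h: "0 < h" "h \<le> 1" using \<delta> by (auto simp: h_def)
  have e1: "(b - a) / h + 1 \<le> (b - a + 1) / h" "(d - c) / h + 1 \<le> (d - c + 1) / h"
    using h by (auto simp: field_simps)
  have "1 \<le> h powr (\<theta> - 1)"
    using h assms powr_mono'[of "\<theta> - 1" 0 h] by simp
  then have e2: "2 * (K * h powr \<theta>) / h + 1 \<le> (2 * K + 1) * h powr (\<theta> - 1)"
    using h by (simp add: powr_diff field_simps)
  have "real (covering_number \<delta> (Gr g ({a..b} \<times> {c..d})))
      \<le> ((b - a) / h + 1) * ((d - c) / h + 1) * (2 * (K * h powr \<theta>) / h + 1)"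
    using covering_number_graph_le[of a b c d h "K * h powr \<theta>" g] assms h
    by (simp add: h_def)
  also have "\<dots> \<le> (b - a + 1) / h * ((d - c + 1) / h) * ((2 * K + 1) * h powr (\<theta> - 1))"
    using assms h by (intro mult_mono e1 e2) auto
  also have "\<dots> = A * (h powr (\<theta> - 1) * h powr (- 2))"
    using h by (simp add: A_def powr_minus power2_eq_square field_simps)
  also have "\<dots> = A * h powr (- (3 - \<theta>))"
    by (simp add: powr_add[symmetric])
  also have "\<dots> = A * 2 powr (3 - \<theta>) * \<delta> powr (- (3 - \<theta>))"
    using \<delta> half_powr[of "3 - \<theta>"] by (simp add: h_def)
  finally show "real (covering_number \<delta> (Gr g ({a..b} \<times> {c..d})))
      \<le> A * 2 powr (3 - \<theta>) * \<delta> powr (- (3 - \<theta>))" .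
qed (use assms in simp)

section \<open>Hausdorff dimension of graphs over rectangles\<close>

text \<open>A set of diameter \<open>r \<le> 1\<close> projects into a square of side \<open>2 r\<close>, of area \<open>4 r\<^sup>2 \<le> 4 r\<^sup>s\<close>.\<close>

lemma projection_of_small_set:
  fixes U :: "(real \<times> real \<times> real) set"
  assumes "bounded U" "diameter U \<le> 1" "s \<le> 2" "0 \<le> s"
  obtains Q where "Q \<in> sets lborel" "(\<lambda>(x, y, z). (x, y)) ` U \<subseteq> Q"
    "emeasure lborel Q \<le> 4 * diam_pow s U"
proof (cases "U = {}")
  case True
  then show ?thesis by (intro that[of "{}"]) auto
next
  case False
  then obtain x0 y0 z0 where p: "(x0, y0, z0) \<in> U" by (metis ex_in_conv prod.exhaust)
  define r where "r = diameter U"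
  have r: "0 \<le> r" "r \<le> 1" using assms diameter_ge_0 by (auto simp: r_def)
  define Q where "Q = cbox (x0 - r, y0 - r) (x0 + r, y0 + r)"
  have proj: "(x, y) \<in> Q" if "(x, y, z) \<in> U" for x y z
  proof -
    have "dist (x, y, z) (x0, y0, z0) \<le> r"
      unfolding r_def by (rule diameter_bounded_bound[OF assms(1) that p])
    then have "dist x x0 \<le> r" "dist y y0 \<le> r"
      using dist_fst_le[of "(x, y, z)" "(x0, y0, z0)"] dist_snd_le[of "(x, y, z)" "(x0, y0, z0)"]
        dist_fst_le[of "(y, z)" "(y0, z0)"] by auto
    then show ?thesis by (auto simp: Q_def dist_real_def)
  qed
  have "emeasure lborel Q = ennreal ((2 * r) * (2 * r))"
    unfolding Q_def using r
    by (subst emeasure_lborel_cbox) (auto simp: Basis_prod_def)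
  also have "ennreal ((2 * r) * (2 * r)) \<le> 4 * diam_pow s U"
  proof (cases "s = 0")
    case True
    have "r * r \<le> 1" using r by (simp add: mult_le_one)
    then have "ennreal ((2 * r) * (2 * r)) \<le> ennreal 4" by (intro ennreal_leI) auto
    then show ?thesis using True False by (simp add: diam_pow_def)
  next
    case s: False
    have "r * r \<le> r powr s"
    proof (cases "r = 0")
      case False
      then have "r powr 2 \<le> r powr s" using r assms by (intro powr_mono') auto
      then show ?thesis using r False by (simp add: power2_eq_square)
    qed simp
    then have "ennreal ((2 * r) * (2 * r)) \<le> ennreal (4 * r powr s)" by (intro ennreal_leI) auto
    then show ?thesis using s False by (simp add: diam_pow_def r_def ennreal_mult')
  qed
  finally have measure: "emeasure lborel Q \<le> 4 * diam_pow s U" .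
  show ?thesis
  proof (rule that[of Q])
    show "Q \<in> sets lborel" by (simp add: Q_def)
    show "(\<lambda>(x, y, z). (x, y)) ` U \<subseteq> Q" using proj by auto
  qed (rule measure)
qed

text \<open>A cover of the graph projects to a cover of the rectangle, which has positive area. So every
  cover by sets of diameter at most 1 has \<open>s\<close>-cost at least a quarter of this area when
  \<open>s \<le> 2\<close>.\<close>

proposition hausdorff_dim_graph_ge:
  fixes g :: "real \<times> real \<Rightarrow> real"
  assumes "a < b" "c < d"
  shows "2 \<le> hausdorff_dim (Gr g ({a..b} \<times> {c..d}))"
proof -
  let ?G = "Gr g ({a..b} \<times> {c..d})"
  have pos: "hausdorff_measure s ?G \<noteq> 0" if s: "0 \<le> s" "s \<le> 2" for s
  proof
    assume "hausdorff_measure s ?G = 0"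
    then have zero: "hausdorff_premeasure 1 s ?G = 0"
      unfolding hausdorff_measure_def by (metis SUP_upper greaterThan_iff le_zero_eq zero_less_one)
    have "emeasure lborel (cbox (a, c) (b, d)) / 4 \<le> hausdorff_premeasure 1 s ?G"
      unfolding hausdorff_premeasure_def
    proof (rule INF_greatest)
      fix U :: "nat \<Rightarrow> (real \<times> real \<times> real) set"
      assume "U \<in> {U. (\<forall>i. small_set 1 (U i)) \<and> ?G \<subseteq> (\<Union>i. U i)}"
      then have U: "\<And>i. bounded (U i)" "\<And>i. diameter (U i) \<le> 1" "?G \<subseteq> (\<Union>i. U i)"
        by (auto simp: small_set_def)
      have "\<exists>Q. Q \<in> sets lborel \<and> (\<lambda>(x, y, z). (x, y)) ` U i \<subseteq> Q \<and>
          emeasure lborel Q \<le> 4 * diam_pow s (U i)" for i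
        using projection_of_small_set[OF U(1,2) s(2,1)] by metis
      then obtain Q where Q: "\<And>i. Q i \<in> sets lborel" "\<And>i. (\<lambda>(x, y, z). (x, y)) ` U i \<subseteq> Q i"
          "\<And>i. emeasure lborel (Q i) \<le> 4 * diam_pow s (U i)"
        by metis
      have "cbox (a, c) (b, d) \<subseteq> (\<Union>i. Q i)"
      proof
        fix p assume "p \<in> cbox (a, c) (b, d)"
        then obtain x y where xy: "p = (x, y)" "x \<in> {a..b}" "y \<in> {c..d}"
          by (cases p) auto
        then have "(x, y, g (x, y)) \<in> ?G" by (auto simp: Gr_def)
        then obtain i where "(x, y, g (x, y)) \<in> U i" using U(3) by blast
        then have "(x, y) \<in> Q i" using Q(2)[of i] by force
        then show "p \<in> (\<Union>i. Q i)" using xy by blast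
      qed
      then have "emeasure lborel (cbox (a, c) (b, d)) \<le> emeasure lborel (\<Union>i. Q i)"
        using Q(1) by (intro emeasure_mono) auto
      also have "\<dots> \<le> (\<Sum>i. emeasure lborel (Q i))"
        using Q(1) by (intro emeasure_subadditive_countably) auto
      also have "\<dots> \<le> (\<Sum>i. 4 * diam_pow s (U i))"
        using Q(3) by (intro suminf_le) auto
      also have "\<dots> = (\<Sum>i. diam_pow s (U i)) * 4" by (simp add: mult.commute)
      finally show "emeasure lborel (cbox (a, c) (b, d)) / 4 \<le> (\<Sum>i. diam_pow s (U i))"
        by (simp add: divide_le_posI_ennreal mult.commute)
    qed
    moreover have "emeasure lborel (cbox (a, c) (b, d)) = ennreal ((b - a) * (d - c))"
      using assms by (subst emeasure_lborel_cbox) (auto simp: Basis_prod_def)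
    moreover have "0 < ennreal ((b - a) * (d - c))"
      using assms by simp
    ultimately show False using zero by (simp add: ennreal_divide_eq_0_iff)
  qed
  have "ereal 2 \<le> hausdorff_dim ?G"
    unfolding hausdorff_dim_def using pos by (intro Inf_greatest) (auto simp: not_le, meson linear)
  then show ?thesis by simp
qed

section \<open>Dimension of the graph of the mixed fractional integral\<close>

theorem theorem3p3:
  fixes a b c d \<gamma>1 \<gamma>2 :: real and f :: "real \<times> real \<Rightarrow> real"
  assumes "0 < a" "a < b" and "0 < c" "c < d"
    and "continuous_on ({a..b} \<times> {c..d}) f"
  defines "G \<equiv> Gr (RL_integral a c \<gamma>1 \<gamma>2 f) ({a..b} \<times> {c..d})"
  shows "(0 < \<gamma>1 \<and> \<gamma>1 < 1 \<and> 0 < \<gamma>2 \<and> \<gamma>2 < 1 \<longrightarrow>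
            2 \<le> hausdorff_dim G \<and>
            hausdorff_dim G \<le> lower_box_dim G \<and>
            lower_box_dim G \<le> upper_box_dim G \<and>
            upper_box_dim G \<le> ereal (3 - min \<gamma>1 \<gamma>2) \<and>
            (\<forall>D. has_box_dim G D \<longrightarrow>
               2 \<le> hausdorff_dim G \<and> hausdorff_dim G \<le> D \<and> D \<le> ereal (3 - min \<gamma>1 \<gamma>2)))
       \<and> (1 \<le> \<gamma>1 \<and> 1 \<le> \<gamma>2 \<longrightarrow>
            hausdorff_dim G = 2 \<and> has_box_dim G 2)"
proof -
  have lower: "2 \<le> hausdorff_dim G"
    unfolding G_def using assms by (intro hausdorff_dim_graph_ge)
  have middle: "lower_box_dim G \<le> upper_box_dim G"
    unfolding lower_box_dim_def upper_box_dim_def by (intro Liminf_le_Limsup) simp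
  have upper: "hausdorff_dim G \<le> lower_box_dim G \<and>
      upper_box_dim G \<le> ereal (3 - min 1 (min \<gamma>1 \<gamma>2))" if pos: "0 < \<gamma>1" "0 < \<gamma>2"
  proof
    define F where "F = RL_integral a c \<gamma>1 \<gamma>2 f"
    define \<theta> where "\<theta> = min 1 (min \<gamma>1 \<gamma>2)"
    obtain B K where K: "0 \<le> K"
      and B: "\<And>x y. x \<in> {a..b} \<Longrightarrow> y \<in> {c..d} \<Longrightarrow> \<bar>F (x, y)\<bar> \<le> B"
      and Hoelder: "\<And>x x' y y'. x \<in> {a..b} \<Longrightarrow> x' \<in> {a..b} \<Longrightarrow> y \<in> {c..d} \<Longrightarrow> y' \<in> {c..d} \<Longrightarrow>
        \<bar>F (x', y') - F (x, y)\<bar> \<le> K * (\<bar>x' - x\<bar> powr min \<gamma>1 1 + \<bar>y' - y\<bar> powr min \<gamma>2 1)"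
      using RL_integral_bounded_and_Hoelder[OF pos assms(5)] unfolding F_def by metis
    have "G \<subseteq> {a..b} \<times> {c..d} \<times> {- B..B}"
      using B unfolding G_def Gr_def F_def[symmetric] by (fastforce simp: abs_le_iff)
    moreover have "bounded ({a..b} \<times> {c..d} \<times> {- B..B})"
      by (intro bounded_Times) auto
    ultimately show "hausdorff_dim G \<le> lower_box_dim G"
      by (intro hausdorff_dim_le_lower_box_dim) (rule bounded_subset)
    show "upper_box_dim G \<le> ereal (3 - min 1 (min \<gamma>1 \<gamma>2))"
      unfolding G_def F_def[symmetric] \<theta>_def[symmetric]
    proof (rule upper_box_dim_graph_le)
      fix h x x' y y' :: real
      assume h: "0 < h" "h \<le> 1"
        and xy: "x \<in> {a..b}" "x' \<in> {a..b}" "y \<in> {c..d}" "y' \<in> {c..d}"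
        and close: "\<bar>x' - x\<bar> \<le> h" "\<bar>y' - y\<bar> \<le> h"
      \<comment> \<open>A larger exponent and a smaller base both decrease the power, as \<open>h \<le> 1\<close>.\<close>
      have scale: "t powr \<alpha> \<le> h powr \<theta>" if "0 \<le> t" "t \<le> h" "\<theta> \<le> \<alpha>" "0 \<le> \<alpha>" for t \<alpha>
        using that h by (meson order_trans powr_mono2 powr_mono' less_imp_le)
      have "\<bar>x' - x\<bar> powr min \<gamma>1 1 + \<bar>y' - y\<bar> powr min \<gamma>2 1 \<le> h powr \<theta> + h powr \<theta>"
        using close pos by (intro add_mono scale) (auto simp: \<theta>_def)
      then have "K * (\<bar>x' - x\<bar> powr min \<gamma>1 1 + \<bar>y' - y\<bar> powr min \<gamma>2 1) \<le> 2 * K * h powr \<theta>"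
        using mult_left_mono[OF _ K] by fastforce
      then show "\<bar>F (x', y') - F (x, y)\<bar> \<le> 2 * K * h powr \<theta>"
        using Hoelder[OF xy] by linarith
    qed (use assms K in \<open>auto simp: \<theta>_def\<close>)
  qed
  show ?thesis
  proof (intro conjI impI)
    assume small: "0 < \<gamma>1 \<and> \<gamma>1 < 1 \<and> 0 < \<gamma>2 \<and> \<gamma>2 < 1"
    then have "min 1 (min \<gamma>1 \<gamma>2) = min \<gamma>1 \<gamma>2" by linarith
    then have bounds: "hausdorff_dim G \<le> lower_box_dim G" "upper_box_dim G \<le> ereal (3 - min \<gamma>1 \<gamma>2)"
      using upper small by metis+
    then show "hausdorff_dim G \<le> lower_box_dim G" "upper_box_dim G \<le> ereal (3 - min \<gamma>1 \<gamma>2)" .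
    show "\<forall>D. has_box_dim G D \<longrightarrow>
        2 \<le> hausdorff_dim G \<and> hausdorff_dim G \<le> D \<and> D \<le> ereal (3 - min \<gamma>1 \<gamma>2)"
      using lower bounds by (auto simp: has_box_dim_def)
  next
    assume large: "1 \<le> \<gamma>1 \<and> 1 \<le> \<gamma>2"
    then have "min 1 (min \<gamma>1 \<gamma>2) = 1" by linarith
    then have "hausdorff_dim G \<le> lower_box_dim G" "upper_box_dim G \<le> 2"
      using upper large by auto
    then show "hausdorff_dim G = 2" "has_box_dim G 2"
      using lower middle unfolding has_box_dim_def by (meson antisym order_trans)+
  qed (use lower middle in auto)
qed

end
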